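(* Let $G$ be a triangle-free graph of order $n$. Then $\phi(G)\le 6^{n/4}$. Furthermore, $\phi(G)=6^{n/4}$ if and only if $n\equiv 0\pmod 4$ and $G$ is isomorphic to the disjoint union of $n/4$ copies of the cycle $C_4$.
   Context: All graphs are finite, simple, undirected and labeled. A subset $F$ of vertices of a graph $G$ is a dissociation set if the induced subgraph $G[F]$ has maximum degree at most $1$. A maximal dissociation set is a dissociation set that is not a proper subset of any other dissociation set. $\phi(G)$ denotes the number of maximal dissociation sets of $G$. *)

theory Defs
  imports Complex_Main
begin

definition simple_graph :: "'a set \<Rightarrow> ('a \<Rightarrow> 'a \<Rightarrow> bool) \<Rightarrow> bool" where
  "simple_graph V E \<longleftrightarrow> finite V \<and> (\<forall>x y. E x y \<longrightarrow> x \<in> V \<and> y \<in> V)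
     \<and> (\<forall>x y. E x y \<longrightarrow> E y x) \<and> (\<forall>x. \<not> E x x)"

definition triangle_free :: "'a set \<Rightarrow> ('a \<Rightarrow> 'a \<Rightarrow> bool) \<Rightarrow> bool" where
  "triangle_free V E \<longleftrightarrow> \<not> (\<exists>x\<in>V. \<exists>y\<in>V. \<exists>z\<in>V. E x y \<and> E y z \<and> E x z)"

definition dissociation_set :: "'a set \<Rightarrow> ('a \<Rightarrow> 'a \<Rightarrow> bool) \<Rightarrow> 'a set \<Rightarrow> bool" where
  "dissociation_set V E F \<longleftrightarrow> F \<subseteq> V \<and> (\<forall>x\<in>F. card {y \<in> F. E x y} \<le> 1)"

definition maximal_dissociation_set :: "'a set \<Rightarrow> ('a \<Rightarrow> 'a \<Rightarrow> bool) \<Rightarrow> 'a set \<Rightarrow> bool" where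
  "maximal_dissociation_set V E F \<longleftrightarrow> dissociation_set V E F \<and>
     \<not> (\<exists>F'. dissociation_set V E F' \<and> F \<subset> F')"

definition phi :: "'a set \<Rightarrow> ('a \<Rightarrow> 'a \<Rightarrow> bool) \<Rightarrow> nat" where
  "phi V E = card {F. maximal_dissociation_set V E F}"

definition graph_iso :: "'a set \<Rightarrow> ('a \<Rightarrow> 'a \<Rightarrow> bool) \<Rightarrow> 'b set \<Rightarrow> ('b \<Rightarrow> 'b \<Rightarrow> bool) \<Rightarrow> bool" where
  "graph_iso V E W D \<longleftrightarrow> (\<exists>f. bij_betw f V W \<and> (\<forall>x\<in>V. \<forall>y\<in>V. E x y \<longleftrightarrow> D (f x) (f y)))"

definition C4_union_verts :: "nat \<Rightarrow> (nat \<times> nat) set" where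
  "C4_union_verts k = {0..<k} \<times> {0..<4}"

definition C4_union_edge :: "nat \<Rightarrow> nat \<times> nat \<Rightarrow> nat \<times> nat \<Rightarrow> bool" where
  "C4_union_edge k u v \<longleftrightarrow> u \<in> C4_union_verts k \<and> v \<in> C4_union_verts k \<and>
     fst u = fst v \<and> (snd v = (snd u + 1) mod 4 \<or> snd u = (snd v + 1) mod 4)"

end

(*
  Every branch below bounds the number of maximal dissociation sets F of G[U] by numbers for
  smaller induced subgraphs: if S is contained in F and has no neighbour in F - S, then F - S is a
  maximal dissociation set of G[U] - N[S]. With beta = 6^(-1/4) and rho(U) = phi(G[U]) beta^|U|,
  a class whose N[S] has at least k vertices contributes at most beta^k to rho(U) by induction.

  The vertex v whose degree is smallest or largest decides which branching is used. Degree at most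
  1 gives rho <= 0.93. If all degrees are at least 2 and some degree is at least 4, branching on
  "v is not in F / v is isolated in F / v is matched to u" gives rho < 1; for degree 4 with all
  neighbours of degree 2, the leaves of G - v supply the missing factor 0.93. If all degrees are
  2 or 3, a vertex v of degree 2 with neighbours a, b is handled by "v isolated / a matched /
  b matched / a and b isolated in F", which gives rho <= 0.982 unless v lies in a C4 component.
  If G is cubic, no component of G - v is a C4 meeting N(v), so rho(G - v) <= 0.982 and the
  branching on v again gives rho < 1. A C4 component contributes the factor
  6 = beta^(-4) exactly, and removing it leaves rho unchanged.
*)
theory Submission
  imports Defs
begin

section \<open>Numerical bounds on the powers of \<open>beta\<close>\<close>

definition beta :: real where "beta = 6 powr (-1/4)"

lemma beta_pos: "0 < beta" and beta_pow4: "beta ^ 4 = 1/6"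
proof -
  show "0 < beta" by (simp add: beta_def)
  have "beta ^ 4 = 6 powr (-1/4 * 4)"
    unfolding beta_def by (simp add: powr_powr flip: powr_numeral)
  then show "beta ^ 4 = 1/6" by (simp add: powr_minus_divide)
qed

text \<open>Only \<open>beta ^ 4 = 1/6\<close> is known exactly, so a decimal, rounded up from the
  true value, is verified by raising it to the fourth power.\<close>

lemma beta_le: "beta \<le> 638944 / 1000000"
proof (rule ccontr)
  assume "\<not> beta \<le> 638944 / 1000000"
  then have "(638944 / 1000000) ^ 4 \<le> beta ^ 4" by (intro power_mono) auto
  then show False unfolding beta_pow4 by (simp add: power4_eq_xxxx)
qed

lemma beta_pow2_le: "beta ^ 2 \<le> 408249 / 1000000"
proof (rule ccontr)
  assume "\<not> beta ^ 2 \<le> 408249 / 1000000"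
  then have "(408249 / 1000000) ^ 2 \<le> (beta ^ 2) ^ 2" by (intro power_mono) auto
  then show False using beta_pow4 by (simp add: power2_eq_square power4_eq_xxxx)
qed

lemma beta_pow3_le: "beta ^ 3 \<le> 26085 / 100000"
proof -
  have "beta * beta ^ 2 \<le> (638944 / 1000000) * (408249 / 1000000)"
    using beta_le beta_pow2_le beta_pos by (intro mult_mono) auto
  then show ?thesis by (simp add: power3_eq_cube power2_eq_square)
qed

lemma beta_powers_le: "beta ^ 5 \<le> 106491 / 1000000" "beta ^ 6 \<le> 68042 / 1000000" "beta ^ 7 \<le> 43475 / 1000000"
proof -
  have "beta ^ 5 = beta ^ 4 * beta" "beta ^ 6 = beta ^ 4 * beta ^ 2" "beta ^ 7 = beta ^ 4 * beta ^ 3"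
    by (simp_all flip: power_add power_Suc2)
  then show "beta ^ 5 \<le> 106491 / 1000000" "beta ^ 6 \<le> 68042 / 1000000" "beta ^ 7 \<le> 43475 / 1000000"
    using beta_le beta_pow2_le beta_pow3_le unfolding beta_pow4 by simp_all
qed

lemma beta_power_decreasing: "m \<le> n \<Longrightarrow> beta ^ n \<le> beta ^ m"
  using beta_pos beta_le by (intro power_decreasing) auto

text \<open>The ratio of consecutive terms is \<open>(k + 1) / k * beta\<close>, which is at most
  \<open>3/2 * beta < 1\<close> for \<open>k\<close> at least 2 but exceeds 1 for
  \<open>k = 1\<close>. This singles out the worst degree when a bound is summed over all neighbours
  of a vertex.\<close>

lemma mult_beta_power_decreasing:
  assumes "2 \<le> m" "m \<le> n"
  shows "real n * beta ^ n \<le> real m * beta ^ m"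
  using assms(2)
proof (induction n rule: dec_induct)
  case (step k)
  have "real (Suc k) * beta \<le> real (Suc k) * (638944 / 1000000)" using beta_le by (intro mult_left_mono) auto
  also have "\<dots> \<le> real k" using assms(1) step(1) by simp
  finally have "real (Suc k) * beta * beta ^ k \<le> real k * beta ^ k"
    using beta_pos by (intro mult_right_mono) auto
  then show ?case using step by (simp add: mult.assoc)
qed simp

section \<open>Branching\<close>

text \<open>The induced subgraphs of a graph are represented by their vertex sets \<open>U\<close>, with the
  same relation \<open>E\<close>; this is harmless as \<open>phi U E\<close> only looks at \<open>E\<close> on \<open>U\<close>.\<close>

locale triangle_free_relation =
  fixes E :: "'a \<Rightarrow> 'a \<Rightarrow> bool"
  assumes sym: "E u v \<Longrightarrow> E v u"
    and irrefl: "\<not> E v v"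
    and no_triangle: "E u v \<Longrightarrow> E v w \<Longrightarrow> \<not> E u w"
begin

section \<open>Neighbourhoods, classes of maximal dissociation sets and normalised counts\<close>

definition N :: "'a set \<Rightarrow> 'a \<Rightarrow> 'a set" where
  "N U v = {u \<in> U. E v u}"

abbreviation deg :: "'a set \<Rightarrow> 'a \<Rightarrow> nat" where
  "deg U v \<equiv> card (N U v)"

definition mds :: "'a set \<Rightarrow> 'a set set" where
  "mds U = {F. maximal_dissociation_set U E F}"

text \<open>For \<open>S\<close> inside \<open>U\<close> this is the closed neighbourhood of
  \<open>S\<close> in the graph induced by \<open>U\<close>.\<close>

definition cl :: "'a set \<Rightarrow> 'a set \<Rightarrow> 'a set" where
  "cl U S = S \<union> (\<Union>s\<in>S. N U s)"

text \<open>The condition forces \<open>S\<close> into \<open>F\<close> and forbids edges between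
  \<open>S\<close> and \<open>F - S\<close>: the set \<open>S\<close> is a union of components of
  the graph induced by \<open>F\<close>.\<close>

definition cls :: "'a set \<Rightarrow> 'a set \<Rightarrow> 'a set set" where
  "cls U S = {F \<in> mds U. F \<inter> cl U S = S}"

text \<open>The contribution of a family \<open>X\<close> to \<open>rho U\<close>; with this
  scaling, a branching becomes a sum of terms that are compared with powers of
  \<open>beta\<close>.\<close>

definition wt :: "'a set \<Rightarrow> 'a set set \<Rightarrow> real" where
  "wt U X = real (card X) * beta ^ card U"

definition rho :: "'a set \<Rightarrow> real" where
  "rho U = real (phi U E) * beta ^ card U"

lemma N_subset: "N U v \<subseteq> U"
  by (auto simp: N_def)

lemma finite_N [simp]: "finite U \<Longrightarrow> finite (N U v)"
  by (auto simp: N_def)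

lemma N_sym: "u \<in> U \<Longrightarrow> v \<in> N U u \<Longrightarrow> u \<in> N U v"
  by (auto simp: N_def sym)

section \<open>Local tests for dissociation and maximality\<close>

lemma diss_iff:
  assumes "finite U"
  shows "dissociation_set U E F \<longleftrightarrow>
    F \<subseteq> U \<and> (\<forall>x\<in>F. \<forall>u\<in>F. \<forall>v\<in>F. E x u \<longrightarrow> E x v \<longrightarrow> u = v)"
proof (cases "F \<subseteq> U")
  case True
  then have "finite F" using assms finite_subset by blast
  then have "card {z \<in> F. E x z} \<le> 1 \<longleftrightarrow> (\<forall>u\<in>F. \<forall>v\<in>F. E x u \<longrightarrow> E x v \<longrightarrow> u = v)" for x
    by (auto simp: card_le_Suc0_iff_eq)
  then show ?thesis using True by (simp add: dissociation_set_def)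
qed (simp add: dissociation_set_def)

text \<open>Subsets of dissociation sets are dissociation sets, so a proper extension exists exactly
  when one by a single vertex does.\<close>

lemma mds_iff:
  assumes "finite U"
  shows "F \<in> mds U \<longleftrightarrow> dissociation_set U E F \<and>
    (\<forall>v\<in>U - F. \<not> dissociation_set U E (insert v F))"
proof -
  have sub: "dissociation_set U E A" if "dissociation_set U E B" "A \<subseteq> B" for A B
    using that unfolding diss_iff[OF assms] by blast
  have "(\<exists>F'. dissociation_set U E F' \<and> F \<subset> F') \<longleftrightarrow> (\<exists>v\<in>U - F. dissociation_set U E (insert v F))"
  proof
    assume "\<exists>F'. dissociation_set U E F' \<and> F \<subset> F'"
    then obtain F' v where F': "dissociation_set U E F'" "F \<subset> F'" "v \<in> F'" "v \<notin> F" by blast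
    moreover have "v \<in> U" using F' by (auto simp: dissociation_set_def)
    ultimately show "\<exists>v\<in>U - F. dissociation_set U E (insert v F)"
      using sub[of F' "insert v F"] by blast
  qed blast
  then show ?thesis unfolding mds_def maximal_dissociation_set_def by blast
qed

lemma mds_subset: "F \<in> mds U \<Longrightarrow> F \<subseteq> U"
  by (simp add: mds_def maximal_dissociation_set_def dissociation_set_def)

lemma finite_mds [simp]: "finite U \<Longrightarrow> finite (mds U)"
  by (rule finite_subset[of _ "Pow U"]) (auto dest: mds_subset)

lemma mds_unique:
  "finite U \<Longrightarrow> F \<in> mds U \<Longrightarrow> x \<in> F \<Longrightarrow> u \<in> F \<Longrightarrow> v \<in> F \<Longrightarrow> E x u \<Longrightarrow> E x v \<Longrightarrow> u = v"
  unfolding mds_iff diss_iff by blast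

text \<open>Adding \<open>v\<close> must create a vertex with two neighbours: either a neighbour of
  \<open>v\<close> that already has a partner in \<open>F\<close>, or \<open>v\<close> itself. The
  branchings on vertices of degree at most 2 rest on these two obstructions.\<close>

lemma mds_blocked:
  assumes "finite U" "F \<in> mds U" "v \<in> U" "v \<notin> F"
  shows "(\<exists>u\<in>F. \<exists>w\<in>F. E v u \<and> E u w) \<or> (\<exists>a\<in>F. \<exists>b\<in>F. a \<noteq> b \<and> E v a \<and> E v b)"
proof -
  have "\<not> dissociation_set U E (insert v F)" "insert v F \<subseteq> U"
    using assms mds_subset by (auto simp: mds_iff)
  then obtain x a b where x: "x \<in> insert v F" "a \<in> insert v F" "b \<in> insert v F"
    "E x a" "E x b" "a \<noteq> b"
    unfolding diss_iff[OF assms(1)] by blast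
  then show ?thesis using mds_unique[OF assms(1,2)] sym irrefl by (metis insert_iff)
qed

lemma phi_eq: "phi U E = card (mds U)"
  by (simp add: phi_def mds_def)

lemma rho_eq_wt: "rho U = wt U (mds U)"
  by (simp add: rho_def wt_def phi_eq)

lemma rho_nonneg: "0 \<le> rho U"
  using beta_pos by (simp add: rho_def)

lemma wt_mono: "finite B \<Longrightarrow> A \<subseteq> B \<Longrightarrow> wt U A \<le> wt U B"
  using beta_pos by (auto simp: wt_def intro!: mult_right_mono card_mono)

lemma wt_Un: "wt U (A \<union> B) \<le> wt U A + wt U B"
proof -
  have "real (card (A \<union> B)) \<le> real (card A) + real (card B)"
    using card_Un_le[of A B] by linarith
  then show ?thesis
    using beta_pos by (simp add: wt_def mult_right_mono flip: distrib_right)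
qed

lemma wt_UN: "finite I \<Longrightarrow> wt U (\<Union>i\<in>I. A i) \<le> (\<Sum>i\<in>I. wt U (A i))"
proof (induction I rule: finite_induct)
  case (insert i I)
  then show ?case using wt_Un[of U "A i" "\<Union>i\<in>I. A i"] by simp
qed (simp add: wt_def)

lemma beta_power_card_diff:
  assumes "finite U" "C \<subseteq> U"
  shows "beta ^ card U = beta ^ card (U - C) * beta ^ card C"
  using assms card_Diff_subset[of C U] card_mono[of U C]
  by (simp add: finite_subset flip: power_add)

lemma cl_subset: "S \<subseteq> U \<Longrightarrow> cl U S \<subseteq> U"
  by (auto simp: cl_def N_def)

lemma S_subset_cl: "S \<subseteq> cl U S"
  by (auto simp: cl_def)

text \<open>No edge joins \<open>S\<close> to the rest of \<open>F\<close>, so the rest stays maximal once the closed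
  neighbourhood of \<open>S\<close> is removed.\<close>
lemma cls_diff:
  assumes "finite U" "S \<subseteq> U" "F \<in> cls U S"
  shows "F - S \<in> mds (U - cl U S)"
proof -
  have F: "F \<in> mds U" "F \<inter> cl U S = S" using assms by (auto simp: cls_def)
  have fin: "finite (U - cl U S)" using assms by blast
  have FU: "F \<subseteq> U" by (rule mds_subset[OF F(1)])
  have SF: "S \<subseteq> F" using F(2) by blast
  have no: "\<not> E s u" "\<not> E u s" if "s \<in> S" "u \<in> U - cl U S" for s u
    using that sym unfolding cl_def N_def by blast+
  show ?thesis
    unfolding mds_iff[OF fin]
  proof (intro conjI ballI notI)
    show "dissociation_set (U - cl U S) E (F - S)"
      unfolding diss_iff[OF fin] using FU F(2) mds_unique[OF assms(1) F(1)] by blast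
  next
    fix v assume v: "v \<in> U - cl U S - (F - S)"
      and d: "dissociation_set (U - cl U S) E (insert v (F - S))"
    have vF: "v \<notin> F" using v S_subset_cl[of S U] by blast
    have "x = z" if "p \<in> insert v F" "x \<in> insert v F" "z \<in> insert v F" "E p x" "E p z" for p x z
    proof (cases "p \<in> S")
      case True
      then have "x \<noteq> v" "z \<noteq> v" using no that v by auto
      then show ?thesis using that True SF mds_unique[OF assms(1) F(1), of p x z] by blast
    next
      case False
      then have p: "p \<in> insert v (F - S)" using that by blast
      then have "p \<in> U - cl U S" using v FU F(2) by blast
      then have "x \<notin> S" "z \<notin> S" using no that by blast+
      then show ?thesis using d p that unfolding diss_iff[OF fin] by blast
    qed
    moreover have "insert v F \<subseteq> U" using v FU by blast
    ultimately have "dissociation_set U E (insert v F)"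
      unfolding diss_iff[OF assms(1)] by blast
    then show False using F(1) v vF unfolding mds_iff[OF assms(1)] by blast
  qed
qed

text \<open>Removing \<open>S\<close> is injective on the class because every member contains
  \<open>S\<close>, and the exponent of \<open>beta\<close> splits along
  \<open>cl U S\<close>.\<close>

lemma wt_cls:
  assumes "finite U" "S \<subseteq> U"
  shows "wt U (cls U S) \<le> rho (U - cl U S) * beta ^ card (cl U S)"
proof -
  have "inj_on (\<lambda>F. F - S) (cls U S)"
    by (rule inj_onI) (auto simp: cls_def)
  then have "card (cls U S) \<le> card (mds (U - cl U S))"
    using assms cls_diff by (intro card_inj_on_le) auto
  then show ?thesis
    using beta_pos beta_power_card_diff[OF assms(1) cl_subset[OF assms(2)]]
    by (auto simp: wt_def rho_eq_wt intro: mult_right_mono)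
qed

lemma wt_cls_le:
  assumes "finite U" "S \<subseteq> U" "rho (U - cl U S) \<le> c" "k \<le> card (cl U S)"
  shows "wt U (cls U S) \<le> c * beta ^ k"
proof -
  have "rho (U - cl U S) * beta ^ card (cl U S) \<le> c * beta ^ k"
    by (rule mult_mono[OF assms(3) beta_power_decreasing[OF assms(4)] order.trans[OF rho_nonneg assms(3)]])
      (simp add: less_imp_le[OF beta_pos])
  then show ?thesis using wt_cls[OF assms(1,2)] by linarith
qed

text \<open>\<open>F\<close> remains a dissociation set, and the vertices whose addition must fail
  are among the former ones.\<close>

lemma mds_delete:
  assumes "finite U" "F \<in> mds U" "v \<notin> F"
  shows "F \<in> mds (U - {v})"
proof -
  have "finite (U - {v})" using assms(1) by simp
  then show ?thesis
    using assms(2,3) unfolding mds_iff[OF assms(1)] mds_iff[OF \<open>finite (U - {v})\<close>]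
      diss_iff[OF assms(1)] diss_iff[OF \<open>finite (U - {v})\<close>]
    by blast
qed

lemma cls_iff:
  "F \<in> cls U S \<longleftrightarrow> F \<in> mds U \<and> S \<subseteq> F \<and> (\<forall>s\<in>S. \<forall>u\<in>F. E s u \<longrightarrow> u \<in> S)"
proof (cases "F \<in> mds U")
  case True
  then have "F \<subseteq> U" by (rule mds_subset)
  then have "F \<inter> cl U S = S \<longleftrightarrow> S \<subseteq> F \<and> (\<forall>s\<in>S. \<forall>u\<in>F. E s u \<longrightarrow> u \<in> S)"
    unfolding cl_def N_def by blast
  then show ?thesis using True by (simp add: cls_def)
qed (simp add: cls_def)

lemma cls_singleton_iff:
  "F \<in> cls U {v} \<longleftrightarrow> F \<in> mds U \<and> v \<in> F \<and> (\<forall>u\<in>F. \<not> E v u)"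
  unfolding cls_iff using irrefl by blast

text \<open>Two adjacent vertices of a dissociation set already use up each other's degree, so an
  edge inside \<open>F\<close> is automatically a component.\<close>

lemma cls_edge_iff:
  assumes "finite U" "E u v"
  shows "F \<in> cls U {u, v} \<longleftrightarrow> F \<in> mds U \<and> u \<in> F \<and> v \<in> F"
  using mds_unique[OF assms(1)] assms(2) sym[OF assms(2)] unfolding cls_iff by blast

lemma cls_pair_iff:
  assumes "\<not> E a b"
  shows "F \<in> cls U {a, b} \<longleftrightarrow> F \<in> mds U \<and> a \<in> F \<and> b \<in> F \<and> (\<forall>u\<in>F. \<not> E a u \<and> \<not> E b u)"
  unfolding cls_iff using assms irrefl sym[of b a] by blast

lemma card_cl_singleton: "finite U \<Longrightarrow> card (cl U {v}) = Suc (deg U v)"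
  using irrefl by (simp add: cl_def N_def)

lemma cl_edge: "u \<in> U \<Longrightarrow> v \<in> U \<Longrightarrow> E u v \<Longrightarrow> cl U {u, v} = N U u \<union> N U v"
  by (auto simp: cl_def N_def sym)

text \<open>Without triangles the two neighbourhoods are disjoint, and each contains the other
  endpoint. This is how triangle-freeness makes the classes of matched pairs cheap.\<close>

lemma card_cl_edge:
  assumes "finite U" "u \<in> U" "v \<in> U" "E u v"
  shows "card (cl U {u, v}) = deg U u + deg U v"
proof -
  have "N U u \<inter> N U v = {}" using no_triangle[OF assms(4)] by (auto simp: N_def)
  then show ?thesis using assms by (simp add: cl_edge card_Un_disjoint)
qed

text \<open>The induction hypothesis of the bound \<open>rho U \<le> 1\<close>.\<close>

definition small :: "'a set \<Rightarrow> bool" where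
  "small U \<longleftrightarrow> finite U \<and> (\<forall>W. W \<subset> U \<longrightarrow> rho W \<le> 1)"

lemma small_finite: "small U \<Longrightarrow> finite U"
  by (simp add: small_def)

lemma small_subset: "small U \<Longrightarrow> W \<subseteq> U \<Longrightarrow> small W"
  unfolding small_def by (meson finite_subset psubset_subset_trans)

lemma small_rho: "small U \<Longrightarrow> v \<in> U \<Longrightarrow> v \<in> C \<Longrightarrow> rho (U - C) \<le> 1"
  unfolding small_def by blast

lemma wt_singleton:
  assumes "small U" "v \<in> U" "rho (U - cl U {v}) \<le> c" "k \<le> Suc (deg U v)"
  shows "wt U (cls U {v}) \<le> c * beta ^ k"
  using assms small_finite by (intro wt_cls_le) (auto simp: card_cl_singleton)

lemma wt_edge:
  assumes "small U" "u \<in> U" "v \<in> U" "E u v" "rho (U - cl U {u, v}) \<le> c" "k \<le> deg U u + deg U v"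
  shows "wt U (cls U {u, v}) \<le> c * beta ^ k"
  using assms small_finite by (intro wt_cls_le) (auto simp: card_cl_edge)

text \<open>The removed part is nonempty, so the induction hypothesis bounds the remainder by
  1.\<close>

lemma wt_edge1:
  assumes "small U" "u \<in> U" "v \<in> N U u" "k \<le> deg U u + deg U v"
  shows "wt U (cls U {u, v}) \<le> beta ^ k"
  using wt_edge[of U u v 1 k] assms small_rho[of U u "cl U {u, v}"] by (auto simp: N_def cl_def)

lemma wt_singleton1:
  assumes "small U" "v \<in> U" "k \<le> Suc (deg U v)"
  shows "wt U (cls U {v}) \<le> beta ^ k"
  using wt_singleton[of U v 1 k] assms small_rho[of U v "cl U {v}"] by (auto simp: cl_def)

text \<open>Either \<open>v\<close> is outside \<open>F\<close>, or it is isolated in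
  \<open>F\<close>, or it is matched in \<open>F\<close> to one neighbour \<open>u\<close>. In the
  first case one vertex is deleted, at the price of a single factor \<open>beta\<close>.\<close>

lemma branch_delete:
  assumes "finite U" "v \<in> U"
  shows "rho U \<le> beta * rho (U - {v}) + wt U (cls U {v}) + (\<Sum>u\<in>N U v. wt U (cls U {v, u}))"
proof -
  have "mds U \<subseteq> mds (U - {v}) \<union> cls U {v} \<union> (\<Union>u\<in>N U v. cls U {v, u})"
  proof
    fix F assume F: "F \<in> mds U"
    show "F \<in> mds (U - {v}) \<union> cls U {v} \<union> (\<Union>u\<in>N U v. cls U {v, u})"
      using mds_delete[OF assms(1) F, of v] F mds_subset[OF F] assms
      by (auto simp: cls_singleton_iff cls_edge_iff N_def)
  qed
  moreover have "finite (mds (U - {v}) \<union> cls U {v} \<union> (\<Union>u\<in>N U v. cls U {v, u}))"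
    using assms by (auto simp: cls_def)
  ultimately have "rho U \<le> wt U (mds (U - {v}) \<union> cls U {v} \<union> (\<Union>u\<in>N U v. cls U {v, u}))"
    unfolding rho_eq_wt by (rule wt_mono[rotated])
  moreover have "wt U (mds (U - {v})) = beta * rho (U - {v})"
    using assms beta_power_card_diff[of U "{v}"] by (simp add: wt_def rho_eq_wt)
  ultimately show ?thesis
    using wt_Un[of U "mds (U - {v}) \<union> cls U {v}" "\<Union>u\<in>N U v. cls U {v, u}"]
      wt_Un[of U "mds (U - {v})" "cls U {v}"] wt_UN[of "N U v" U "\<lambda>u. cls U {v, u}"] assms
    by simp
qed

lemma branch_isolated:
  assumes "finite U" "v \<in> U" "N U v = {}"
  shows "rho U \<le> wt U (cls U {v})"
proof -
  have "F \<in> cls U {v}" if F: "F \<in> mds U" for F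
  proof -
    have no: "\<not> E v u" if "u \<in> F" for u using that mds_subset[OF F] assms(3) by (auto simp: N_def)
    then have "v \<in> F" using mds_blocked[OF assms(1) F assms(2)] by blast
    then show ?thesis using no F assms by (simp add: cls_singleton_iff)
  qed
  then show ?thesis unfolding rho_eq_wt using assms
    by (intro wt_mono) (auto simp: cls_def)
qed

text \<open>If \<open>u\<close> is outside \<open>F\<close>, nothing blocks \<open>v\<close>, so
  \<open>v\<close> lies in \<open>F\<close> and is isolated there. If \<open>u\<close> is in
  \<open>F\<close>, it is matched: to \<open>v\<close> if \<open>v\<close> is in \<open>F\<close>,
  and otherwise to some vertex because \<open>v\<close> has to be blocked.\<close>

lemma branch_leaf:
  assumes "finite U" "v \<in> U" "N U v = {u}"
  shows "rho U \<le> wt U (cls U {v}) + (\<Sum>w\<in>N U u. wt U (cls U {u, w}))"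
proof -
  have u: "u \<in> U" "E v u" using assms(3) by (auto simp: N_def)
  have "mds U \<subseteq> cls U {v} \<union> (\<Union>w\<in>N U u. cls U {u, w})"
  proof
    fix F assume F: "F \<in> mds U"
    have only: "x = u" if "x \<in> F" "E v x" for x
      using that mds_subset[OF F] assms(3) by (auto simp: N_def)
    consider "v \<in> F" "u \<notin> F" | "v \<in> F" "u \<in> F" | w where "u \<in> F" "w \<in> F" "E u w"
      using mds_blocked[OF assms(1) F assms(2)] only by blast
    then show "F \<in> cls U {v} \<union> (\<Union>w\<in>N U u. cls U {u, w})"
    proof cases
      case 1
      then show ?thesis using F only assms by (auto simp: cls_singleton_iff)
    next
      case 2
      then have "v \<in> N U u" using u sym assms by (auto simp: N_def)
      then show ?thesis using 2 F u assms sym[OF u(2)] cls_edge_iff[of U u v F] by blast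
    next
      case 3
      then have "w \<in> N U u" using mds_subset[OF F] by (auto simp: N_def)
      then show ?thesis using 3 F u assms cls_edge_iff[of U u w F] N_subset[of U u] by blast
    qed
  qed
  moreover have "finite (cls U {v} \<union> (\<Union>w\<in>N U u. cls U {u, w}))"
    using assms by (auto simp: cls_def)
  ultimately have "rho U \<le> wt U (cls U {v} \<union> (\<Union>w\<in>N U u. cls U {u, w}))"
    unfolding rho_eq_wt by (rule wt_mono[rotated])
  then show ?thesis
    using wt_Un[of U "cls U {v}" "\<Union>w\<in>N U u. cls U {u, w}"]
      wt_UN[of "N U u" U "\<lambda>w. cls U {u, w}"] assms by simp
qed

text \<open>If \<open>v\<close> is in \<open>F\<close>, it is isolated or matched to
  \<open>a\<close> or \<open>b\<close>, and the latter is counted among the matchings of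
  \<open>a\<close> and \<open>b\<close>. If \<open>v\<close> is not in \<open>F\<close>, it is
  blocked by a matched neighbour or by both \<open>a\<close> and \<open>b\<close>; when neither is
  matched, both are isolated in \<open>F\<close>.\<close>

lemma branch_two:
  assumes "finite U" "v \<in> U" "N U v = {a, b}" "a \<noteq> b"
  shows "rho U \<le> wt U (cls U {v}) + (\<Sum>w\<in>N U a. wt U (cls U {a, w}))
    + (\<Sum>w\<in>N U b. wt U (cls U {b, w})) + wt U (cls U {a, b})"
proof -
  let ?R = "cls U {v} \<union> (\<Union>w\<in>N U a. cls U {a, w}) \<union> (\<Union>w\<in>N U b. cls U {b, w}) \<union> cls U {a, b}"
  have ab: "a \<in> U" "E v a" "b \<in> U" "E v b" using assms(3) by (auto simp: N_def)
  then have nab: "\<not> E a b" using no_triangle[of v a b] by blast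
  have "mds U \<subseteq> ?R"
  proof
    fix F assume F: "F \<in> mds U"
    have only: "x = a \<or> x = b" if "x \<in> F" "E v x" for x
      using that mds_subset[OF F] assms(3) by (auto simp: N_def)
    have edge: "F \<in> (\<Union>w\<in>N U x. cls U {x, w})" if "x \<in> F" "w \<in> F" "E x w" for x w
      using that F mds_subset[OF F] cls_edge_iff[of U x w F] assms(1) by (auto simp: N_def)
    have "(v \<in> F \<and> a \<notin> F \<and> b \<notin> F) \<or> (\<exists>x\<in>{a, b}. x \<in> F \<and> (\<exists>w\<in>F. E x w)) \<or> (a \<in> F \<and> b \<in> F)"
    proof (cases "v \<in> F")
      case True
      then show ?thesis using sym[OF ab(2)] sym[OF ab(4)] by blast
    next
      case False
      then show ?thesis using mds_blocked[OF assms(1) F assms(2) False] only by blast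
    qed
    then consider "v \<in> F" "a \<notin> F" "b \<notin> F" | x w where "x \<in> {a, b}" "x \<in> F" "w \<in> F" "E x w"
      | "a \<in> F" "b \<in> F" "\<forall>w\<in>F. \<not> E a w \<and> \<not> E b w"
      by blast
    then show "F \<in> ?R"
    proof cases
      case 1
      then show ?thesis using F only assms by (auto simp: cls_singleton_iff)
    next
      case 2
      then show ?thesis using edge by blast
    next
      case 3
      then show ?thesis using F cls_pair_iff[OF nab, of F U] by simp
    qed
  qed
  moreover have "finite ?R"
    using assms by (auto simp: cls_def)
  ultimately have "rho U \<le> wt U ?R"
    unfolding rho_eq_wt by (rule wt_mono[rotated])
  also have "\<dots> \<le> wt U (cls U {v}) + wt U (\<Union>w\<in>N U a. cls U {a, w})
      + wt U (\<Union>w\<in>N U b. cls U {b, w}) + wt U (cls U {a, b})"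
    by (intro order.trans[OF wt_Un] add_mono order_refl)
  finally show ?thesis
    using wt_UN[of "N U a" U "\<lambda>w. cls U {a, w}"] wt_UN[of "N U b" U "\<lambda>w. cls U {b, w}"]
      assms(1) by simp
qed

section \<open>Reducible configurations\<close>

lemma N_diff: "N (U - C) v = N U v - C"
  by (auto simp: N_def)

lemma rho_isolated:
  assumes "small U" "v \<in> U" "N U v = {}"
  shows "rho U \<le> beta"
  using branch_isolated[of U v] wt_singleton1[of U v 1] assms small_finite by fastforce

lemma rho_leaf:
  assumes "small U" "v \<in> U" "deg U v \<le> 1"
  shows "rho U \<le> 93 / 100"
proof (cases "N U v = {}")
  case True
  then show ?thesis using rho_isolated[of U v] assms beta_le by simp
next
  case False
  have fin: "finite U" by (rule small_finite[OF assms(1)])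
  then have "0 < deg U v" using False by (simp add: card_gt_0_iff)
  then have d1: "deg U v = 1" using assms(3) by linarith
  then obtain u where Nv: "N U v = {u}" by (auto simp: card_1_singleton_iff)
  then have u: "u \<in> U" "E v u" by (auto simp: N_def)
  have vu: "v \<in> N U u" using u sym assms(2) by (auto simp: N_def)
  let ?d = "deg U u"
  have d0: "0 < ?d" using vu fin by (auto simp: card_gt_0_iff)
  have bound: "wt U (cls U {u, w}) \<le> beta ^ (?d + 1)" if "w \<in> N U u" for w
  proof (rule wt_edge1[OF assms(1) u(1) that])
    have "u \<in> N U w" by (rule N_sym[OF u(1) that])
    then have "0 < deg U w" using fin by (auto simp: card_gt_0_iff)
    then show "?d + 1 \<le> ?d + deg U w" by simp
  qed
  have "(\<Sum>w\<in>N U u. wt U (cls U {u, w})) \<le> ?d * beta ^ (?d + 1)"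
    using bound by (rule sum_bounded_above)
  \<comment> \<open>The worst degree of \<open>u\<close> is 2. Degree 1 is treated apart because
    \<open>n * beta ^ n\<close> decreases only from \<open>n = 2\<close> on; there
    \<open>beta\<close> at least \<open>1/2\<close> suffices. The total is then
    \<open>beta ^ 2 + 2 * beta ^ 3\<close>, just below 0.93.\<close>
  also have "\<dots> \<le> 2 * beta ^ 3"
  proof (cases "?d = 1")
    case True
    have "1 \<le> 2 * beta"
    proof (rule ccontr)
      assume "\<not> 1 \<le> 2 * beta"
      then have "beta ^ 4 < (1/2) ^ 4" using beta_pos by (intro power_strict_mono) auto
      then show False unfolding beta_pow4 by (simp add: power4_eq_xxxx)
    qed
    then have "1 * beta ^ 2 \<le> 2 * beta * beta ^ 2" by (rule mult_right_mono) simp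
    moreover have "beta ^ 3 = beta * beta ^ 2" by (simp flip: power_Suc)
    ultimately show ?thesis using True by (simp add: mult.assoc power2_eq_square)
  next
    case False
    then have "real ?d * beta ^ ?d \<le> real 2 * beta ^ 2" using d0 by (intro mult_beta_power_decreasing) auto
    then have "real ?d * beta ^ ?d * beta \<le> real 2 * beta ^ 2 * beta"
      using beta_pos by (rule mult_right_mono[OF _ less_imp_le])
    moreover have "beta ^ (?d + 1) = beta ^ ?d * beta" "beta ^ 3 = beta ^ 2 * beta"
      by (simp_all flip: power_Suc2)
    ultimately show ?thesis by (simp add: mult_ac)
  qed
  finally have "(\<Sum>w\<in>N U u. wt U (cls U {u, w})) \<le> 2 * beta ^ 3" .
  moreover have "wt U (cls U {v}) \<le> beta ^ 2" using assms(1,2) d1 by (intro wt_singleton1) auto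
  ultimately show ?thesis
    using branch_leaf[OF fin assms(2) Nv] beta_pow2_le beta_pow3_le by linarith
qed

lemma rho_diff_isolated:
  assumes "small U" "v \<in> U" "v \<notin> C" "N U v \<subseteq> C"
  shows "rho (U - C) \<le> beta"
  using assms small_subset[of U "U - C"] by (intro rho_isolated[of _ v]) (auto simp: N_diff)

text \<open>Removing a neighbour of a vertex of degree at most 2 leaves a vertex of degree at most
  1, which improves the bound on the remainder from 1 to 0.93.\<close>

lemma rho_diff_leaf:
  assumes "small U" "v \<in> U" "v \<notin> C" "deg U v \<le> 2" "u \<in> N U v" "u \<in> C"
  shows "rho (U - C) \<le> 93 / 100"
proof (rule rho_leaf[of _ v])
  show "small (U - C)" using assms(1) by (rule small_subset) blast
  have "card (N U v - C) \<le> card (N U v - {u})"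
    using assms small_finite by (intro card_mono) auto
  also have "\<dots> \<le> 1" using assms by simp
  finally show "deg (U - C) v \<le> 1" by (simp add: N_diff)
qed (use assms in auto)

section \<open>A vertex of degree at least 4\<close>

lemma rho_lt_1_deg_ge_5:
  assumes "small U" "v \<in> U" "5 \<le> deg U v" "\<forall>u\<in>U. 2 \<le> deg U u"
  shows "rho U < 1"
proof -
  let ?d = "deg U v"
  have "wt U (cls U {v, u}) \<le> beta ^ (?d + 2)" if "u \<in> N U v" for u
    using that assms N_subset[of U v] by (intro wt_edge1) auto
  then have "(\<Sum>u\<in>N U v. wt U (cls U {v, u})) \<le> ?d * beta ^ (?d + 2)"
    by (rule sum_bounded_above)
  also have "\<dots> = ?d * beta ^ ?d * beta ^ 2" by (simp add: power_add power2_eq_square)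
  \<comment> \<open>Degree 5 is the worst case; the total
    \<open>beta + beta ^ 6 + 5 * beta ^ 7\<close> is below 0.93.\<close>
  also have "\<dots> \<le> real 5 * beta ^ 5 * beta ^ 2" using assms(3) by (intro mult_right_mono mult_beta_power_decreasing) auto
  also have "\<dots> = 5 * beta ^ 7" by (simp flip: power_add)
  finally have "(\<Sum>u\<in>N U v. wt U (cls U {v, u})) \<le> 5 * beta ^ 7" .
  moreover have "wt U (cls U {v}) \<le> beta ^ 6" using assms by (intro wt_singleton1) auto
  moreover have "beta * rho (U - {v}) \<le> beta * 1"
    using small_rho[OF assms(1,2), of "{v}"] beta_pos by (intro mult_left_mono) auto
  ultimately show ?thesis
    using branch_delete[OF small_finite[OF assms(1)] assms(2)] beta_le beta_powers_le by linarith
qed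

text \<open>One neighbour \<open>v\<close> is kept apart, since its degree is often known better
  than, or differs from, that of the others.\<close>

lemma sum_wt_edges:
  assumes "small U" "a \<in> U" "v \<in> N U a" "k \<le> deg U a + deg U v"
    and "\<And>w. w \<in> N U a \<Longrightarrow> w \<noteq> v \<Longrightarrow> m \<le> deg U a + deg U w"
  shows "(\<Sum>w\<in>N U a. wt U (cls U {a, w})) \<le> beta ^ k + real (deg U a - 1) * beta ^ m"
proof -
  have fin: "finite (N U a)" using small_finite[OF assms(1)] by simp
  have "(\<Sum>w\<in>N U a - {v}. wt U (cls U {a, w})) \<le> real (card (N U a - {v})) * beta ^ m"
    using assms by (intro sum_bounded_above wt_edge1) auto
  moreover have "wt U (cls U {a, v}) \<le> beta ^ k" using assms by (intro wt_edge1) auto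
  ultimately show ?thesis using assms(3) fin by (simp add: sum.remove[of _ v])
qed

lemma rho_lt_1_deg_4:
  assumes "small U" "v \<in> U" "deg U v = 4" "\<forall>u\<in>U. 2 \<le> deg U u"
  shows "rho U < 1"
proof -
  have fin: "finite U" by (rule small_finite[OF assms(1)])
  have branch: "rho U \<le> beta * rho (U - {v}) + wt U (cls U {v}) + (\<Sum>u\<in>N U v. wt U (cls U {v, u}))"
    by (rule branch_delete[OF fin assms(2)])
  have v: "wt U (cls U {v}) \<le> beta ^ 5" using assms by (intro wt_singleton1) auto
  have two: "2 \<le> deg U w" if "w \<in> N U v" for w using that assms(4) N_subset by blast
  obtain u0 where u0: "u0 \<in> N U v" using assms(3) by fastforce
  show ?thesis
  \<comment> \<open>The crude total \<open>beta + beta ^ 5 + 4 * beta ^ 6\<close> slightly exceeds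
    1. A neighbour of degree at least 3 turns one \<open>beta ^ 6\<close> into
    \<open>beta ^ 7\<close>; otherwise all neighbours of \<open>v\<close> have degree 2, so
    \<open>U - {v}\<close> has a leaf and its bound drops to 0.93.\<close>
  proof (cases "\<exists>u\<in>N U v. 3 \<le> deg U u")
    case True
    then obtain u where u: "u \<in> N U v" "3 \<le> deg U u" by blast
    have "(\<Sum>w\<in>N U v. wt U (cls U {v, w})) \<le> beta ^ 7 + real (deg U v - 1) * beta ^ 6"
      using u two assms(3) by (intro sum_wt_edges[OF assms(1,2) u(1)]) auto
    moreover have "beta * rho (U - {v}) \<le> beta * 1"
      using small_rho[OF assms(1,2), of "{v}"] beta_pos by (intro mult_left_mono) auto
    ultimately show ?thesis using branch v assms(3) beta_le beta_powers_le by simp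
  next
    case False
    have "(\<Sum>w\<in>N U v. wt U (cls U {v, w})) \<le> beta ^ 6 + real (deg U v - 1) * beta ^ 6"
      using u0 two assms(3) by (intro sum_wt_edges[OF assms(1,2) u0]) auto
    moreover have "rho (U - {v}) \<le> 93 / 100"
      using False u0 N_sym[OF assms(2) u0] assms irrefl
      by (intro rho_diff_leaf[of _ u0 _ v]) (auto simp: N_def not_le)
    then have "beta * rho (U - {v}) \<le> beta * (93 / 100)"
      using beta_pos by (intro mult_left_mono) auto
    ultimately show ?thesis using branch v assms(3) beta_le beta_powers_le by simp
  qed
qed

section \<open>A vertex of degree 2 when all degrees are 2 or 3\<close>

lemma card_cl_common_neighbour:
  assumes "finite U" "N U v = {a, b}" "a \<noteq> b"
  shows "card (cl U {a, b}) = 2 + card (N U a \<union> N U b)"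
proof -
  have "E v a" "E v b" using assms by (auto simp: N_def)
  \<comment> \<open>The common neighbour \<open>v\<close> makes an edge between \<open>a\<close> and
    \<open>b\<close> impossible.\<close>
  then have "{a, b} \<inter> (N U a \<union> N U b) = {}"
    using no_triangle[of v a b] no_triangle[of v b a] irrefl by (auto simp: N_def)
  moreover have "cl U {a, b} = {a, b} \<union> (N U a \<union> N U b)" by (auto simp: cl_def)
  ultimately show ?thesis using assms by (simp add: card_Un_disjoint)
qed

lemma wt_pair:
  assumes "small U" "a \<in> U" "k \<le> card (cl U {a, b})" "b \<in> U"
  shows "wt U (cls U {a, b}) \<le> beta ^ k"
  using wt_cls_le[of U "{a, b}" 1 k] small_rho[OF assms(1,2), of "cl U {a, b}"] assms small_finite
  by (auto simp: cl_def)

lemma rho_deg_2_33: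
  assumes "small U" "v \<in> U" "N U v = {a, b}" "a \<noteq> b" "deg U a = 3" "deg U b = 3"
    and two: "\<forall>u\<in>U. 2 \<le> deg U u"
  shows "rho U \<le> 982 / 1000"
proof -
  have fin: "finite U" by (rule small_finite[OF assms(1)])
  have ab: "a \<in> U" "b \<in> U" "v \<in> N U a" "v \<in> N U b"
    using assms(2,3) N_sym[of v U a] N_sym[of v U b] by (auto simp: N_def sym)
  have dv: "deg U v = 2" using assms(3,4) by simp
  have two': "2 \<le> deg U w" if "w \<in> N U x" for w x using that two N_subset by blast
  note branch = branch_two[OF fin assms(2-4)]
  have v: "wt U (cls U {v}) \<le> beta ^ 3" using assms(1,2) dv by (intro wt_singleton1) auto
  have sa: "(\<Sum>w\<in>N U a. wt U (cls U {a, w})) \<le> beta ^ 5 + real (deg U a - 1) * beta ^ 5"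
    using assms(5) dv two' by (intro sum_wt_edges[OF assms(1) ab(1,3)]) auto
  have sb: "(\<Sum>w\<in>N U b. wt U (cls U {b, w})) \<le> beta ^ 5 + real (deg U b - 1) * beta ^ 5"
    using assms(6) dv two' by (intro sum_wt_edges[OF assms(1) ab(2,4)]) auto
  note pair = wt_pair[OF assms(1) ab(1) _ ab(2)]
  note ccl = card_cl_common_neighbour[OF fin assms(3,4)]
  show ?thesis
  proof (cases "N U a = N U b")
    case False
    \<comment> \<open>Two distinct 3-sets have a union of size at least 4, so the closed
      neighbourhood of \<open>{a, b}\<close> has at least 6 vertices.\<close>
    have "N U a \<subset> N U a \<union> N U b"
      using False card_subset_eq[of "N U a" "N U b"] fin assms(5,6) by auto
    then have "deg U a < card (N U a \<union> N U b)" using fin by (intro psubset_card_mono) auto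
    then have "wt U (cls U {a, b}) \<le> beta ^ 6" using assms(5) ccl by (intro pair) auto
    then show ?thesis using branch v sa sb beta_pow3_le beta_powers_le assms(5,6) by simp
  next
    case True
    have p: "wt U (cls U {a, b}) \<le> beta ^ 5" using True assms(5) ccl by (intro pair) auto
    show ?thesis
    proof (cases "\<exists>w\<in>N U a - {v}. deg U w = 2")
      case w: True
      then obtain w where w: "w \<in> N U a" "w \<noteq> v" "deg U w = 2" by blast
      \<comment> \<open>Such a \<open>w\<close> is adjacent only to \<open>a\<close> and
        \<open>b\<close>, so it becomes isolated once the closed neighbourhood of \<open>v\<close>
        is removed. The class of \<open>v\<close> thereby gains a factor
        \<open>beta\<close>.\<close>
      have "{a, b} \<subseteq> N U w" using w(1) True N_sym[OF ab(1), of w] N_sym[OF ab(2), of w] by simp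
      then have "N U w = {a, b}" using w(3) assms(4) fin by (intro card_subset_eq[symmetric]) auto
      moreover have "w \<noteq> a" "w \<noteq> b" using w(1) True irrefl by (auto simp: N_def)
      ultimately have "rho (U - cl U {v}) \<le> beta"
        using w N_subset[of U a] assms(1,3) by (intro rho_diff_isolated[of _ w]) (auto simp: cl_def)
      then have "wt U (cls U {v}) \<le> beta * beta ^ 3" using assms(1,2) dv by (intro wt_singleton) auto
      also have "\<dots> = beta ^ 4" by (simp add: power_Suc[symmetric] del: power_Suc)
      finally show ?thesis using branch sa sb p beta_powers_le beta_pow4 assms(5,6) by simp
    next
      case False
      then have three: "3 \<le> deg U w" if "w \<in> N U a" "w \<noteq> v" for w
        using that two'[OF that(1)] by (metis DiffI Suc_leI empty_iff insert_iff le_neq_implies_less numeral_2_eq_2 numeral_3_eq_3)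
      have "(\<Sum>w\<in>N U a. wt U (cls U {a, w})) \<le> beta ^ 5 + real (deg U a - 1) * beta ^ 6"
        using assms(5) dv three by (intro sum_wt_edges[OF assms(1) ab(1,3)]) fastforce+
      then show ?thesis using branch v sb p beta_pow3_le beta_powers_le assms(5,6) by simp
    qed
  qed
qed

text \<open>The gain over the crude estimate comes from \<open>w\<close>, the second neighbour of
  \<open>a\<close>: from its degree if that is at least 3, from its isolation if it has degree 2 and
  is adjacent to \<open>b\<close>, and otherwise from its enlarging the closed neighbourhood of
  \<open>{a, b}\<close>.\<close>

lemma rho_deg_2_23:
  assumes "small U" "v \<in> U" "N U v = {a, b}" "a \<noteq> b" "deg U a = 2" "deg U b = 3"
    and two: "\<forall>u\<in>U. 2 \<le> deg U u"
  shows "rho U \<le> 982 / 1000"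
proof -
  have fin: "finite U" by (rule small_finite[OF assms(1)])
  have ab: "a \<in> U" "b \<in> U" "v \<in> N U a" "v \<in> N U b"
    using assms(2,3) N_sym[of v U a] N_sym[of v U b] by (auto simp: N_def sym)
  have dv: "deg U v = 2" using assms(3,4) by simp
  have two': "2 \<le> deg U w" if "w \<in> N U x" for w x using that two N_subset by blast
  note branch = branch_two[OF fin assms(2-4)]
  have v: "wt U (cls U {v}) \<le> beta ^ 3" using assms(1,2) dv by (intro wt_singleton1) auto
  have "card (N U a - {v}) = 1" using ab(3) assms(5) by simp
  then obtain w where w: "N U a - {v} = {w}" by (auto simp: card_1_singleton_iff)
  then have w: "N U a = {v, w}" "w \<noteq> v" "w \<in> U" using ab(3) N_subset[of U a] by auto
  have sa: "(\<Sum>x\<in>N U a. wt U (cls U {a, x})) \<le> beta ^ 4 + real (deg U a - 1) * beta ^ k"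
    if "k \<le> 2 + deg U w" for k
    using assms(5) dv that w(1) by (intro sum_wt_edges[OF assms(1) ab(1,3)]) auto
  have sb: "(\<Sum>w\<in>N U b. wt U (cls U {b, w})) \<le> beta ^ 5 + real (deg U b - 1) * beta ^ 5"
    using assms(6) dv two' by (intro sum_wt_edges[OF assms(1) ab(2,4)]) auto
  note pair = wt_pair[OF assms(1) ab(1) _ ab(2)]
  note ccl = card_cl_common_neighbour[OF fin assms(3,4)]
  have "deg U b \<le> card (N U a \<union> N U b)" using fin by (intro card_mono) auto
  then have p: "wt U (cls U {a, b}) \<le> beta ^ 5" using assms(6) ccl by (intro pair) auto
  show ?thesis
  proof (cases "3 \<le> deg U w")
    case True
    then show ?thesis using branch v sa[of 5] sb p beta_pow3_le beta_pow4 beta_powers_le assms(5,6) by simp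
  next
    case False
    then have dw: "deg U w = 2" using two w(3) by force
    show ?thesis
    proof (cases "w \<in> N U b")
      case True
      have "{a, b} \<subseteq> N U w" using w True ab N_sym[of a U w] N_sym[of b U w] by blast
      then have "N U w = {a, b}" using dw assms(4) fin by (intro card_subset_eq[symmetric]) auto
      moreover have "w \<noteq> a" "w \<noteq> b" using w(1) True irrefl by (auto simp: N_def)
      ultimately have "rho (U - cl U {v}) \<le> beta"
        using w assms(1,3) by (intro rho_diff_isolated[of _ w]) (auto simp: cl_def)
      then have "wt U (cls U {v}) \<le> beta * beta ^ 3" using assms(1,2) dv by (intro wt_singleton) auto
      also have "\<dots> = beta ^ 4" by (simp add: power_Suc[symmetric] del: power_Suc)
      finally show ?thesis using branch sa[of 4] dw sb p beta_powers_le beta_pow4 assms(5,6) by simp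
    next
      case False
      \<comment> \<open>This case fixes the constant 0.982: the total is
        \<open>beta ^ 3 + 2 * beta ^ 4 + 3 * beta ^ 5 + beta ^ 6\<close>.\<close>
      have "N U b \<subset> N U a \<union> N U b" using False w by auto
      then have "deg U b < card (N U a \<union> N U b)" using fin by (intro psubset_card_mono) auto
      then have "wt U (cls U {a, b}) \<le> beta ^ 6" using assms(6) ccl by (intro pair) auto
      then show ?thesis using branch v sa[of 4] dw sb beta_pow3_le beta_pow4 beta_powers_le assms(5,6) by simp
    qed
  qed
qed

text \<open>Prescribing the full neighbourhoods in \<open>U\<close> makes the cycle a whole
  component rather than just a subgraph. Consecutive vertices differ because \<open>E\<close> is
  irreflexive.\<close>

definition C4_at :: "'a set \<Rightarrow> 'a \<Rightarrow> 'a \<Rightarrow> 'a \<Rightarrow> 'a \<Rightarrow> bool" where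
  "C4_at U a b c d \<longleftrightarrow> {a, b, c, d} \<subseteq> U \<and> a \<noteq> c \<and> b \<noteq> d \<and>
    N U a = {b, d} \<and> N U b = {a, c} \<and> N U c = {b, d} \<and> N U d = {a, c}"

lemma rho_deg_2_22:
  assumes "small U" "v \<in> U" "N U v = {a, b}" "a \<noteq> b" "deg U a = 2" "deg U b = 2"
    and two: "\<forall>u\<in>U. 2 \<le> deg U u" and noC4: "\<And>w. \<not> C4_at U v a w b"
  shows "rho U \<le> 982 / 1000"
proof -
  have fin: "finite U" by (rule small_finite[OF assms(1)])
  have ab: "a \<in> U" "b \<in> U" "v \<in> N U a" "v \<in> N U b"
    using assms(2,3) N_sym[of v U a] N_sym[of v U b] by (auto simp: N_def sym)
  have dv: "deg U v = 2" using assms(3,4) by simp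
  note branch = branch_two[OF fin assms(2-4)]
  have v: "wt U (cls U {v}) \<le> beta ^ 3" using assms(1,2) dv by (intro wt_singleton1) auto
  have "card (N U a - {v}) = 1" using ab(3) assms(5) by simp
  then obtain w where w: "N U a - {v} = {w}" by (auto simp: card_1_singleton_iff)
  then have w: "N U a = {v, w}" "w \<noteq> v" "w \<in> U" using ab(3) N_subset[of U a] by auto
  have "card (N U b - {v}) = 1" using ab(4) assms(6) by simp
  then obtain x where x: "N U b - {v} = {x}" by (auto simp: card_1_singleton_iff)
  then have x: "N U b = {v, x}" "x \<noteq> v" "x \<in> U" using ab(4) N_subset[of U b] by auto
  have sa: "(\<Sum>z\<in>N U a. wt U (cls U {a, z})) \<le> beta ^ 4 + real (deg U a - 1) * beta ^ k"
    if "k \<le> 2 + deg U w" for k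
    using assms(5) dv that w(1) by (intro sum_wt_edges[OF assms(1) ab(1,3)]) auto
  have sb: "(\<Sum>z\<in>N U b. wt U (cls U {b, z})) \<le> beta ^ 4 + real (deg U b - 1) * beta ^ k"
    if "k \<le> 2 + deg U x" for k
    using assms(6) dv that x(1) by (intro sum_wt_edges[OF assms(1) ab(2,4)]) auto
  note pair = wt_pair[OF assms(1) ab(1) _ ab(2)]
  note ccl = card_cl_common_neighbour[OF fin assms(3,4)]
  have aw: "a \<in> N U w" "b \<in> N U x" using N_sym[OF ab(1)] N_sym[OF ab(2)] w x by auto
  have tw: "2 \<le> deg U w" "2 \<le> deg U x" using two w x by auto
  have ne: "w \<noteq> a" "w \<noteq> b" "x \<noteq> a" "x \<noteq> b"
  proof -
    show "w \<noteq> a" "x \<noteq> b" using w x irrefl by (auto simp: N_def)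
    have "E v a" "E v b" "E a w" "E b x" using w(1) x(1) assms(3) by (auto simp: N_def)
    then show "w \<noteq> b" "x \<noteq> a" using no_triangle[of v a b] no_triangle[of v b a] by auto
  qed
  show ?thesis
  \<comment> \<open>Here \<open>w\<close> and \<open>x\<close> are the second neighbours of
    \<open>a\<close> and \<open>b\<close>. If they coincide, \<open>v, a, w, b\<close> form a cycle,
    which is not a component, so \<open>w\<close> must have a third neighbour.\<close>
  proof (cases "w = x")
    case True
    then have ab_w: "{a, b} \<subseteq> N U w" using aw by simp
    have "3 \<le> deg U w"
    proof (rule ccontr)
      assume "\<not> 3 \<le> deg U w"
      then have "N U w = {a, b}" using ab_w tw assms(4) fin
        by (intro card_subset_eq[symmetric]) auto
      then have "C4_at U v a w b"
        using assms(2-4) ab w x True unfolding C4_at_def by auto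
      then show False using noC4 by blast
    qed
    moreover have "wt U (cls U {a, b}) \<le> beta ^ 4"
      using ccl w x True by (intro pair) auto
    ultimately show ?thesis
      using branch v sa[of 5] sb[of 5] True beta_pow3_le beta_pow4 beta_powers_le assms(5,6) by simp
  next
    case False
    have p: "wt U (cls U {a, b}) \<le> beta ^ 5"
      using ccl w x False by (intro pair) (auto simp: insert_commute)
    consider "3 \<le> deg U w" | "3 \<le> deg U x" | "deg U w = 2" "deg U x = 2" using tw by linarith
    then show ?thesis
    proof cases
      case 1
      then show ?thesis using tw branch v sa[of 5] sb[of 4] p beta_pow3_le beta_pow4 beta_powers_le assms(5,6) by simp
    next
      case 2
      then show ?thesis using tw branch v sa[of 4] sb[of 5] p beta_pow3_le beta_pow4 beta_powers_le assms(5,6) by simp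
    next
      case 3
      \<comment> \<open>Now \<open>w, a, v, b, x\<close> is a path of five vertices of degree 2.
        Removing the closed neighbourhood of \<open>v\<close> or of any of the path's four edges
        cuts a surviving path vertex down to degree at most 1, so each of these five classes gains
        the factor 0.93.\<close>
      have b_w: "b \<notin> N U w" and a_x: "a \<notin> N U x"
        using N_sym[of w U b] N_sym[of x U a] w x False by auto
      have "wt U (cls U {v}) \<le> (93 / 100) * beta ^ 3"
        using assms(1-3) dv aw 3 w ne
        by (intro wt_singleton rho_diff_leaf[of _ w _ a]) (auto simp: cl_def)
      moreover have "wt U (cls U {a, v}) \<le> (93 / 100) * beta ^ 4"
        using assms(1-6) dv aw 3 w x ne ab False
        by (intro wt_edge rho_diff_leaf[of _ x _ b]) (auto simp: cl_def N_def)
      moreover have "wt U (cls U {b, v}) \<le> (93 / 100) * beta ^ 4"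
        using assms(1-6) dv aw 3 w x ne ab False
        by (intro wt_edge rho_diff_leaf[of _ w _ a]) (auto simp: cl_def N_def)
      moreover have "wt U (cls U {a, w}) \<le> (93 / 100) * beta ^ 4"
        using assms(1-6) dv aw 3 w x ne ab False b_w
        by (intro wt_edge rho_diff_leaf[of _ b _ v]) (auto simp: cl_def N_def)
      moreover have "wt U (cls U {b, x}) \<le> (93 / 100) * beta ^ 4"
        using assms(1-6) dv aw 3 w x ne ab False a_x
        by (intro wt_edge rho_diff_leaf[of _ a _ v]) (auto simp: cl_def N_def)
      ultimately show ?thesis using branch p w x beta_pow3_le beta_pow4 beta_powers_le by simp
    qed
  qed
qed

lemma rho_deg_2:
  assumes "small U" "v \<in> U" "deg U v = 2"
    and range: "\<forall>u\<in>U. 2 \<le> deg U u \<and> deg U u \<le> 3" and noC4: "\<And>a b w. \<not> C4_at U v a w b"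
  shows "rho U \<le> 982 / 1000"
proof -
  obtain a b where ab: "N U v = {a, b}" "a \<noteq> b" using assms(3) by (auto simp: card_2_iff)
  then have ba: "N U v = {b, a}" by blast
  have "a \<in> U" "b \<in> U" using ab N_subset[of U v] by auto
  then have "deg U a = 2 \<or> deg U a = 3" "deg U b = 2 \<or> deg U b = 3"
    using range by (metis le_antisym not_less_eq_eq numeral_2_eq_2 numeral_3_eq_3)+
  then show ?thesis
    using rho_deg_2_33[OF assms(1,2) ab] rho_deg_2_23[OF assms(1,2) ab] rho_deg_2_23[OF assms(1,2) ba]
      rho_deg_2_22[OF assms(1,2) ab] ab(2) range noC4 by blast
qed

section \<open>Cubic graphs, and the strict bound in the absence of a 4-cycle component\<close>

lemma rho_lt_1_cubic:
  assumes "small U" "v \<in> U" "\<forall>u\<in>U. deg U u = 3"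
  shows "rho U < 1"
proof -
  have fin: "finite U" by (rule small_finite[OF assms(1)])
  have dv: "deg U v = 3" using assms by blast
  obtain a where a: "a \<in> N U v" using dv by fastforce
  have deg': "deg (U - {v}) u = (if v \<in> N U u then 2 else 3)" if "u \<in> U" for u
    using that assms(3) by (simp add: N_diff)
  have adj: "E v u" if "u \<in> U" "deg (U - {v}) u = 2" for u
    using that deg'[of u] sym by (auto simp: N_def split: if_splits)
  \<comment> \<open>The induction bound 1 for \<open>U - {v}\<close> would be too weak. Deleting
    \<open>v\<close> lowers exactly its neighbours to degree 2, so a 4-cycle component through
    \<open>a\<close> would consist of neighbours of \<open>v\<close>, and two consecutive ones would
    form a triangle with \<open>v\<close>.\<close>
  have "rho (U - {v}) \<le> 982 / 1000"
  proof (rule rho_deg_2[of _ a])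
    show "small (U - {v})" using assms(1) by (rule small_subset) blast
    show "a \<in> U - {v}" using a irrefl by (auto simp: N_def)
    show "deg (U - {v}) a = 2" using deg'[of a] a N_sym[OF assms(2) a] by (auto simp: N_def)
    show "\<forall>u\<in>U - {v}. 2 \<le> deg (U - {v}) u \<and> deg (U - {v}) u \<le> 3" using deg' by auto
    show "\<not> C4_at (U - {v}) a b w c" for b w c
    proof
      assume C: "C4_at (U - {v}) a b w c"
      then have "E v b" "b \<in> N (U - {v}) a" by (auto simp: C4_at_def intro!: adj)
      then show False using a no_triangle[of v a b] by (auto simp: N_def)
    qed
  qed
  then have "beta * rho (U - {v}) \<le> beta * (982 / 1000)" using beta_pos by (intro mult_left_mono) auto
  moreover have "(\<Sum>w\<in>N U v. wt U (cls U {v, w})) \<le> beta ^ 6 + real (deg U v - 1) * beta ^ 6"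
    using a dv assms(3) N_subset[of U v] by (intro sum_wt_edges[OF assms(1,2) a]) auto
  moreover have "wt U (cls U {v}) \<le> beta ^ 4" using assms dv by (intro wt_singleton1) auto
  ultimately show ?thesis
    using branch_delete[OF fin assms(2)] dv beta_le beta_pow4 beta_powers_le by simp
qed

lemma rho_lt_1:
  assumes "small U" "U \<noteq> {}" "\<And>a b c d. \<not> C4_at U a b c d"
  shows "rho U < 1"
proof (cases "\<exists>v\<in>U. deg U v \<le> 1")
  case True
  then obtain v where "v \<in> U" "deg U v \<le> 1" by blast
  then show ?thesis using rho_leaf[OF assms(1), of v] by linarith
next
  case False
  have two: "\<forall>v\<in>U. 2 \<le> deg U v"
  proof
    fix v assume "v \<in> U"
    then have "\<not> deg U v \<le> 1" using False by blast
    then show "2 \<le> deg U v" by linarith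
  qed
  show ?thesis
  proof (cases "\<exists>v\<in>U. 4 \<le> deg U v")
    case True
    then obtain v where v: "v \<in> U" "4 \<le> deg U v" by blast
    then consider "deg U v = 4" | "5 \<le> deg U v" by linarith
    then show ?thesis
      using rho_lt_1_deg_ge_5[OF assms(1) v(1) _ two] rho_lt_1_deg_4[OF assms(1) v(1) _ two]
      by cases
  next
    case False
    have three: "deg U v = 2 \<or> deg U v = 3" if "v \<in> U" for v
    proof -
      have "\<not> 4 \<le> deg U v" "2 \<le> deg U v" using False two that by blast+
      then show ?thesis by linarith
    qed
    show ?thesis
    proof (cases "\<exists>v\<in>U. deg U v = 2")
      case True
      then obtain v where v: "v \<in> U" "deg U v = 2" by blast
      have "\<forall>u\<in>U. 2 \<le> deg U u \<and> deg U u \<le> 3" using three by fastforce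
      then have "rho U \<le> 982 / 1000" using rho_deg_2[OF assms(1) v] assms(3) by blast
      then show ?thesis by linarith
    next
      case False
      then have "\<forall>v\<in>U. deg U v = 3" using three by blast
      then show ?thesis using rho_lt_1_cubic[OF assms(1)] assms(2) by blast
    qed
  qed
qed

section \<open>Components isomorphic to the 4-cycle\<close>

text \<open>With no edges between \<open>C\<close> and the rest, both dissociation and the effect of
  adding one vertex can be tested on each side separately.\<close>

lemma mds_component:
  assumes "finite U" "C \<subseteq> U" "\<And>c u. c \<in> C \<Longrightarrow> u \<in> U - C \<Longrightarrow> \<not> E c u"
  shows "F \<in> mds U \<longleftrightarrow> F \<subseteq> U \<and> F \<inter> C \<in> mds C \<and> F - C \<in> mds (U - C)"
proof -
  have fin: "finite C" "finite (U - C)" using assms finite_subset by auto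
  have diss: "dissociation_set U E A \<longleftrightarrow> dissociation_set C E (A \<inter> C)
      \<and> dissociation_set (U - C) E (A - C)" if "A \<subseteq> U" for A
  proof
    assume "dissociation_set U E A"
    then show "dissociation_set C E (A \<inter> C) \<and> dissociation_set (U - C) E (A - C)"
      unfolding diss_iff[OF assms(1)] diss_iff[OF fin(1)] diss_iff[OF fin(2)] by blast
  next
    assume d: "dissociation_set C E (A \<inter> C) \<and> dissociation_set (U - C) E (A - C)"
    have "u = v" if "x \<in> A" "u \<in> A" "v \<in> A" "E x u" "E x v" for x u v
    proof (cases "x \<in> C")
      case True
      then have "u \<in> C" "v \<in> C" using that assms(3) \<open>A \<subseteq> U\<close> by blast+
      then show ?thesis using d that True unfolding diss_iff[OF fin(1)] by blast
    next
      case False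
      then have "u \<notin> C" "v \<notin> C" using that assms(3)[of u x] assms(3)[of v x] sym \<open>A \<subseteq> U\<close> by blast+
      then show ?thesis using d that False unfolding diss_iff[OF fin(2)] by blast
    qed
    then show "dissociation_set U E A" unfolding diss_iff[OF assms(1)] using that by blast
  qed
  show ?thesis
  proof (cases "F \<subseteq> U \<and> dissociation_set U E F")
    case True
    then have F: "F \<subseteq> U" "dissociation_set C E (F \<inter> C)" "dissociation_set (U - C) E (F - C)"
      using diss by auto
    have "dissociation_set U E (insert v F) \<longleftrightarrow> dissociation_set C E (insert v (F \<inter> C))"
      if "v \<in> C" for v
    proof -
      have "insert v F \<inter> C = insert v (F \<inter> C)" "insert v F - C = F - C" "insert v F \<subseteq> U"
        using that F assms(2) by auto
      then show ?thesis using F diss[of "insert v F"] by simp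
    qed
    moreover have "dissociation_set U E (insert v F) \<longleftrightarrow> dissociation_set (U - C) E (insert v (F - C))"
      if "v \<in> U - C" for v
    proof -
      have "insert v F \<inter> C = F \<inter> C" "insert v F - C = insert v (F - C)" "insert v F \<subseteq> U"
        using that F by auto
      then show ?thesis using F diss[of "insert v F"] by simp
    qed
    moreover have "(\<forall>v\<in>U - F. P v) \<longleftrightarrow> (\<forall>v\<in>C - F \<inter> C. P v) \<and> (\<forall>v\<in>U - C - (F - C). P v)" for P
      using assms(2) by blast
    ultimately show ?thesis
      using F True mds_iff[OF assms(1), of F] mds_iff[OF fin(1), of "F \<inter> C"]
        mds_iff[OF fin(2), of "F - C"] by fastforce
  next
    case False
    then show ?thesis
      using diss[of F] mds_subset[of F U] mds_iff[OF assms(1), of F] mds_iff[OF fin(1), of "F \<inter> C"]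
        mds_iff[OF fin(2), of "F - C"] by blast
  qed
qed

lemma phi_component:
  assumes "finite U" "C \<subseteq> U" "\<And>c u. c \<in> C \<Longrightarrow> u \<in> U - C \<Longrightarrow> \<not> E c u"
  shows "phi U E = phi C E * phi (U - C) E"
proof -
  have "bij_betw (\<lambda>F. (F \<inter> C, F - C)) (mds U) (mds C \<times> mds (U - C))"
    unfolding bij_betw_def
  proof
    show "inj_on (\<lambda>F. (F \<inter> C, F - C)) (mds U)" by (rule inj_onI) blast
    show "(\<lambda>F. (F \<inter> C, F - C)) ` mds U = mds C \<times> mds (U - C)"
    proof (intro equalityI subsetI)
      fix p assume "p \<in> (\<lambda>F. (F \<inter> C, F - C)) ` mds U"
      then obtain F where "F \<in> mds U" "p = (F \<inter> C, F - C)" by blast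
      then show "p \<in> mds C \<times> mds (U - C)" using mds_component[OF assms, of F] by simp
    next
      fix p assume "p \<in> mds C \<times> mds (U - C)"
      then obtain A B where p: "p = (A, B)" "A \<in> mds C" "B \<in> mds (U - C)" by blast
      have "A \<subseteq> C" "B \<subseteq> U - C" using p mds_subset by blast+
      then have AB: "(A \<union> B) \<inter> C = A" "A \<union> B - C = B" "A \<union> B \<subseteq> U" using assms(2) by blast+
      have "A \<union> B \<in> mds U" using mds_component[OF assms, of "A \<union> B"] p AB by simp
      moreover have "p = ((A \<union> B) \<inter> C, A \<union> B - C)" using AB p by simp
      ultimately show "p \<in> (\<lambda>F. (F \<inter> C, F - C)) ` mds U" by (rule rev_image_eqI)
    qed
  qed
  then have "card (mds U) = card (mds C \<times> mds (U - C))" by (rule bij_betw_same_card)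
  then show ?thesis by (simp add: phi_eq card_cartesian_product)
qed

text \<open>Any three vertices of the cycle contain a vertex with two neighbours, while two vertices
  never do. The maximal dissociation sets are thus the \<open>4 choose 2\<close> pairs.\<close>

lemma phi_C4:
  assumes "E a b" "E b c" "E c d" "E d a" "a \<noteq> c" "b \<noteq> d"
  shows "phi {a, b, c, d} E = 6"
proof -
  let ?C = "{a, b, c, d}"
  have ne: "a \<noteq> b" "b \<noteq> c" "c \<noteq> d" "d \<noteq> a" using assms irrefl by auto
  have card_C: "card ?C = 4" using ne assms by auto
  have fin: "finite ?C" by simp
  note assms' = assms(1-4)[THEN sym]
  have diss: "dissociation_set ?C E F \<longleftrightarrow> card F \<le> 2" if F: "F \<subseteq> ?C" for F
  proof
    assume d: "dissociation_set ?C E F"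
    have no: "\<not> {p, q, r} \<subseteq> F" if "E q p" "E q r" "p \<noteq> r" for p q r
      using d that unfolding diss_iff[OF fin] by blast
    \<comment> \<open>The four 3-subsets, with middle vertex \<open>b\<close>, \<open>c\<close>,
      \<open>d\<close> and \<open>a\<close> in turn.\<close>
    note n = no[OF assms'(1) assms(2,5)] no[OF assms'(2) assms(3,6)]
      no[OF assms'(3) assms(4) assms(5)[symmetric]] no[OF assms'(4) assms(1) assms(6)[symmetric]]
    show "card F \<le> 2"
    proof (rule ccontr)
      assume "\<not> card F \<le> 2"
      then have "card (?C - F) \<le> 1"
        using card_Diff_subset[OF finite_subset[OF F fin] F] card_C by linarith
      moreover have "finite (?C - F)" using fin by blast
      ultimately have one: "\<forall>p\<in>?C - F. \<forall>q\<in>?C - F. p = q"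
        by (simp only: card_le_Suc0_iff_eq One_nat_def)
      obtain p where p: "p \<in> {a, b, c}" "p \<notin> F" using n(1) by blast
      have rest: "q \<in> F" if "q \<in> ?C" "q \<noteq> p" for q
      proof (rule ccontr)
        assume "q \<notin> F"
        then show False using one p that by blast
      qed
      from p(1) have "p = a \<or> p = b \<or> p = c" by blast
      then show False
      proof (elim disjE)
        assume "p = a"
        then have "b \<in> F" "c \<in> F" "d \<in> F" using ne assms(5,6) by (auto intro: rest)
        then show False using n(2) by blast
      next
        assume "p = b"
        then have "a \<in> F" "c \<in> F" "d \<in> F" using ne assms(5,6) by (auto intro: rest)
        then show False using n(3) by blast
      next
        assume "p = c"
        then have "a \<in> F" "b \<in> F" "d \<in> F" using ne assms(5,6) by (auto intro: rest)
        then show False using n(4) by blast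
      qed
    qed
  next
    assume c: "card F \<le> 2"
    have finF: "finite F" using F by (rule finite_subset) simp
    have "u = v" if "x \<in> F" "u \<in> F" "v \<in> F" "E x u" "E x v" for x u v
    proof (rule ccontr)
      assume "u \<noteq> v"
      moreover have "x \<noteq> u" "x \<noteq> v" using that irrefl by auto
      ultimately have "card {x, u, v} = 3" by simp
      moreover have "card {x, u, v} \<le> card F" using that finF by (intro card_mono) auto
      ultimately show False using c by simp
    qed
    then show "dissociation_set ?C E F" unfolding diss_iff[OF fin] using F by blast
  qed
  have "mds ?C = {F. F \<subseteq> ?C \<and> card F = 2}"
  proof (rule set_eqI, rule iffI)
    fix F assume F: "F \<in> mds ?C"
    then have sub: "F \<subseteq> ?C" by (rule mds_subset)
    have le: "card F \<le> 2" using F diss[OF sub] unfolding mds_iff[OF fin] by blast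
    have finF: "finite F" using sub by (rule finite_subset) simp
    have "card F = 2"
    proof (rule ccontr)
      assume "card F \<noteq> 2"
      then have lt: "card F < 2" using le by simp
      then have "F \<noteq> ?C" using card_C by auto
      then obtain v where v: "v \<in> ?C" "v \<notin> F" using sub by blast
      then have "card (insert v F) \<le> 2" using lt finF by simp
      then have "dissociation_set ?C E (insert v F)" using diss[of "insert v F"] sub v by blast
      then show False using F v unfolding mds_iff[OF fin] by blast
    qed
    then show "F \<in> {F. F \<subseteq> ?C \<and> card F = 2}" using sub by blast
  next
    fix F assume F: "F \<in> {F. F \<subseteq> ?C \<and> card F = 2}"
    then have finF: "finite F" using finite_subset[OF _ fin] by blast
    show "F \<in> mds ?C" unfolding mds_iff[OF fin]
    proof (intro conjI ballI)
      show "dissociation_set ?C E F" using F diss[of F] by simp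
      fix v assume v: "v \<in> ?C - F"
      then have "card (insert v F) = 3" using F finF by simp
      then show "\<not> dissociation_set ?C E (insert v F)" using diss[of "insert v F"] v F by auto
    qed
  qed
  then have "phi ?C E = card ?C choose 2" by (simp add: phi_eq n_subsets)
  then show ?thesis by (simp add: card_C numeral_eq_Suc)
qed

lemma rho_C4_component:
  assumes "finite U" "E a b" "E b c" "E c d" "E d a" "a \<noteq> c" "b \<noteq> d"
    and "{a, b, c, d} \<subseteq> U" "\<And>x u. x \<in> {a, b, c, d} \<Longrightarrow> u \<in> U - {a, b, c, d} \<Longrightarrow> \<not> E x u"
  shows "rho U = rho (U - {a, b, c, d})"
proof -
  have "a \<noteq> b" "b \<noteq> c" "c \<noteq> d" "d \<noteq> a" using assms irrefl by auto
  then have "card {a, b, c, d} = 4" using assms by auto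
  then have "beta ^ card U = beta ^ card (U - {a, b, c, d}) * (1/6)"
    using beta_power_card_diff[OF assms(1,8)] by (simp only: beta_pow4)
  moreover have "phi U E = 6 * phi (U - {a, b, c, d}) E"
    using phi_component[OF assms(1,8,9)] phi_C4[OF assms(2-7)] by simp
  ultimately show ?thesis by (simp add: rho_def)
qed

text \<open>An intrinsic description of the extremal graphs whose inductive step mirrors the removal
  of a 4-cycle component; the comparison with the concrete model is made separately.\<close>

inductive C4_union :: "'a set \<Rightarrow> bool" where
  empty: "C4_union {}"
| add: "\<lbrakk>C4_union U; {a, b, c, d} \<inter> U = {}; E a b; E b c; E c d; E d a; a \<noteq> c; b \<noteq> d;
    \<forall>x\<in>{a, b, c, d}. \<forall>u\<in>U. \<not> E x u\<rbrakk> \<Longrightarrow> C4_union (U \<union> {a, b, c, d})"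

lemma C4_union_finite: "C4_union U \<Longrightarrow> finite U"
  by (induction rule: C4_union.induct) auto

lemma rho_empty: "rho {} = 1"
proof -
  have "mds {} = {{}}" using mds_iff[of "{}"] diss_iff[of "{}"] by auto
  then show ?thesis by (simp add: rho_def phi_eq)
qed

lemma rho_C4_union: "C4_union U \<Longrightarrow> rho U = 1"
proof (induction rule: C4_union.induct)
  case (add U a b c d)
  then have "U \<union> {a, b, c, d} - {a, b, c, d} = U" by blast
  moreover have "rho (U \<union> {a, b, c, d}) = rho (U \<union> {a, b, c, d} - {a, b, c, d})"
    using add C4_union_finite[of U] by (intro rho_C4_component) auto
  ultimately show ?case using add.IH by simp
qed (rule rho_empty)

text \<open>Bound and equality case share one induction: removing a 4-cycle component keeps
  \<open>rho\<close>, and a nonempty graph without such a component has \<open>rho\<close> strictly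
  below 1.\<close>

lemma rho_bound: "finite U \<Longrightarrow> rho U \<le> 1 \<and> (rho U = 1 \<longrightarrow> C4_union U)"
proof (induction U rule: finite_psubset_induct)
  case (psubset U)
  show ?case
  proof (cases "\<exists>a b c d. C4_at U a b c d")
    case True
    then obtain a b c d where C: "C4_at U a b c d" by blast
    let ?C = "{a, b, c, d}"
    have sub: "?C \<subseteq> U" and ne: "a \<noteq> c" "b \<noteq> d" and Ns: "N U a = {b, d}" "N U b = {a, c}"
      "N U c = {b, d}" "N U d = {a, c}" using C by (auto simp: C4_at_def)
    have E: "E a b" "E b c" "E c d" "E d a" using Ns by (auto simp: N_def)
    have no: "\<not> E x u" if "x \<in> ?C" "u \<in> U - ?C" for x u
    proof
      assume "E x u"
      then have "u \<in> N U x" using that by (simp add: N_def)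
      then show False using that Ns by auto
    qed
    have eq: "rho U = rho (U - ?C)"
      using psubset.hyps E ne sub no by (rule rho_C4_component)
    have IH: "rho (U - ?C) \<le> 1 \<and> (rho (U - ?C) = 1 \<longrightarrow> C4_union (U - ?C))"
      using sub by (intro psubset.IH) blast
    have "C4_union (U - ?C \<union> ?C)" if "C4_union (U - ?C)"
      using that E ne no by (intro C4_union.add) auto
    moreover have "U - ?C \<union> ?C = U" using sub by blast
    ultimately show ?thesis using IH eq by simp
  next
    case False
    have "small U" using psubset by (auto simp: small_def)
    then show ?thesis
      using rho_lt_1[of U] False rho_empty C4_union.empty by (cases "U = {}") auto
  qed
qed

section \<open>Comparison with the standard union of 4-cycles\<close>

lemma C4_union_imp_iso:
  "C4_union U \<Longrightarrow> \<exists>k. card U = 4 * k \<and> graph_iso U E (C4_union_verts k) (C4_union_edge k)"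
proof (induction rule: C4_union.induct)
  case empty
  have "graph_iso {} E (C4_union_verts 0) (C4_union_edge 0)"
    by (auto simp: graph_iso_def C4_union_verts_def bij_betw_def)
  then show ?case by (intro exI[of _ 0]) simp
next
  case (add U a b c d)
  let ?C = "{a, b, c, d}"
  obtain k f where k: "card U = 4 * k" and f: "bij_betw f U (C4_union_verts k)"
    "\<forall>x\<in>U. \<forall>z\<in>U. E x z \<longleftrightarrow> C4_union_edge k (f x) (f z)"
    using add.IH unfolding graph_iso_def by blast
  have ne: "a \<noteq> b" "b \<noteq> c" "c \<noteq> d" "d \<noteq> a" "a \<noteq> c" "b \<noteq> d" using add irrefl by auto
  have edges: "E a b" "E b a" "E b c" "E c b" "E c d" "E d c" "E d a" "E a d"
    using add.hyps sym by auto
  \<comment> \<open>A diagonal would close a triangle with two sides of the cycle.\<close>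
  have nonedges: "\<not> E a c" "\<not> E c a" "\<not> E b d" "\<not> E d b"
    using edges no_triangle by blast+
  define j where "j x = (if x = a then 0 else if x = b then 1 else if x = c then 2 else 3 :: nat)" for x
  have j: "j a = 0" "j b = 1" "j c = 2" "j d = 3" using ne by (auto simp: j_def)
  \<comment> \<open>The old vertices keep their places in layers below \<open>k\<close>; the new
    cycle fills layer \<open>k\<close>, with \<open>j\<close> giving the position on it.\<close>
  define g where "g x = (if x \<in> U then f x else (k, j x))" for x
  have gU: "g x = f x" if "x \<in> U" for x using that by (simp add: g_def)
  have gC: "g x = (k, j x)" if "x \<in> ?C" for x using that add.hyps(2) by (auto simp: g_def)
  have fst_f: "f x \<in> C4_union_verts k" "fst (f x) < k" if "x \<in> U" for x
    using bij_betw_apply[OF f(1) that] by (auto simp: C4_union_verts_def)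
  have jC: "inj_on j ?C" "j ` ?C = {0..<4}" using ne j by (auto simp: inj_on_def)
  have "bij_betw g U (C4_union_verts k)" using f(1) gU by (simp cong: bij_betw_cong)
  moreover have "bij_betw g ?C ({k} \<times> {0..<4})"
  proof -
    have "g ` ?C = (\<lambda>x. (k, j x)) ` ?C" using gC by (rule image_cong[OF refl])
    also have "\<dots> = {k} \<times> (j ` ?C)" by blast
    finally have "g ` ?C = {k} \<times> {0..<4}" by (simp only: jC(2))
    moreover have "inj_on g ?C" using jC(1) gC by (simp add: inj_on_def)
    ultimately show ?thesis by (simp add: bij_betw_def)
  qed
  ultimately have "bij_betw g (U \<union> ?C) (C4_union_verts k \<union> {k} \<times> {0..<4})"
    by (rule bij_betw_combine) (auto simp: C4_union_verts_def)
  moreover have "C4_union_verts k \<union> {k} \<times> {0..<4} = C4_union_verts (Suc k)"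
    by (auto simp: C4_union_verts_def)
  ultimately have "bij_betw g (U \<union> ?C) (C4_union_verts (Suc k))" by simp
  moreover have "E x z \<longleftrightarrow> C4_union_edge (Suc k) (g x) (g z)" if xz: "x \<in> U \<union> ?C" "z \<in> U \<union> ?C" for x z
  proof -
    consider "x \<in> U" "z \<in> U" | "x \<in> U" "z \<in> ?C" | "x \<in> ?C" "z \<in> U" | "x \<in> ?C" "z \<in> ?C"
      using xz by blast
    then show ?thesis
    proof cases
      case 1
      then show ?thesis using f(2) fst_f gU
        by (auto simp: C4_union_edge_def C4_union_verts_def mem_Times_iff less_SucI)
    next
      case 2
      then have "\<not> E x z" using add.hyps(9) sym by blast
      moreover have "fst (g x) < k" "fst (g z) = k" using 2 gU gC fst_f by auto
      ultimately show ?thesis by (auto simp: C4_union_edge_def)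
    next
      case 3
      then have "\<not> E x z" using add.hyps by blast
      moreover have "fst (g z) < k" "fst (g x) = k" using 3 gU gC fst_f by auto
      ultimately show ?thesis by (auto simp: C4_union_edge_def)
    next
      case 4
      have "E x z \<longleftrightarrow> j z = (j x + 1) mod 4 \<or> j x = (j z + 1) mod 4"
        using 4 j edges nonedges irrefl by auto
      moreover have "j x < 4" "j z < 4" by (simp_all add: j_def)
      ultimately show ?thesis using 4 gC by (simp add: C4_union_edge_def C4_union_verts_def)
    qed
  qed
  ultimately have "graph_iso (U \<union> ?C) E (C4_union_verts (Suc k)) (C4_union_edge (Suc k))"
    unfolding graph_iso_def by blast
  moreover have "card (U \<union> ?C) = 4 * Suc k"
    using k add.hyps(2) C4_union_finite[OF add.hyps(1)] ne by (subst card_Un_disjoint) auto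
  ultimately show ?case by blast
qed

text \<open>The preimage of the last layer is a 4-cycle without edges to the other layers, so it can
  be peeled off, and the same map identifies the rest with the smaller model.\<close>

lemma iso_imp_C4_union:
  "graph_iso U E (C4_union_verts k) (C4_union_edge k) \<Longrightarrow> C4_union U"
proof (induction k arbitrary: U)
  case 0
  then have "U = {}" by (auto simp: graph_iso_def C4_union_verts_def bij_betw_def)
  then show ?case by (simp add: C4_union.empty)
next
  case (Suc k)
  then obtain f where f: "bij_betw f U (C4_union_verts (Suc k))"
    "\<forall>x\<in>U. \<forall>z\<in>U. E x z \<longleftrightarrow> C4_union_edge (Suc k) (f x) (f z)"
    unfolding graph_iso_def by blast
  define h where "h = the_inv_into U f"
  have h: "h p \<in> U" "f (h p) = p" if "p \<in> C4_union_verts (Suc k)" for p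
    using that f(1) by (auto simp: h_def bij_betw_def the_inv_into_into f_the_inv_into_f)
  have hf: "h (f x) = x" if "x \<in> U" for x
    using that f(1) by (simp add: h_def bij_betw_def the_inv_into_f_f)
  have vert: "(k, i) \<in> C4_union_verts (Suc k)" if "i < 4" for i
    using that by (simp add: C4_union_verts_def)
  define W where "W = {x \<in> U. fst (f x) < k}"
  \<comment> \<open>The vertices of the last cycle, in cyclic order.\<close>
  define c where "c i = h (k, i)" for i :: nat
  have c: "c i \<in> U" "f (c i) = (k, i)" if "i < 4" for i
    using h[OF vert[OF that]] by (simp_all add: c_def)
  have edge: "E (c i) (c i')" if "i < 4" "i' < 4" "i' = (i + 1) mod 4" for i i'
    using f(2) c that vert by (simp add: C4_union_edge_def)
  have "x \<in> W \<union> {c 0, c 1, c 2, c 3}" if xU: "x \<in> U" for x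
  proof (rule ccontr)
    assume "x \<notin> W \<union> {c 0, c 1, c 2, c 3}"
    moreover have "f x \<in> C4_union_verts (Suc k)" using f(1) xU by (rule bij_betw_apply)
    ultimately obtain i where i: "f x = (k, i)" "i < 4"
      using xU by (cases "f x") (auto simp: W_def C4_union_verts_def less_Suc_eq)
    have "x = c i" using hf[OF xU] i by (simp add: c_def)
    moreover have "i = 0 \<or> i = 1 \<or> i = 2 \<or> i = 3" using i by linarith
    ultimately show False using \<open>x \<notin> W \<union> {c 0, c 1, c 2, c 3}\<close> by blast
  qed
  then have U: "U = W \<union> {c 0, c 1, c 2, c 3}" using c by (auto simp: W_def)
  have "bij_betw f W (f ` W)"
    using f(1) by (auto simp: W_def bij_betw_def intro: inj_on_subset)
  moreover have "f ` W = C4_union_verts k"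
  proof (intro equalityI subsetI)
    fix p assume "p \<in> f ` W"
    then obtain x where "x \<in> U" "fst (f x) < k" "p = f x" by (auto simp: W_def)
    then show "p \<in> C4_union_verts k" using bij_betw_apply[OF f(1), of x]
      by (auto simp: C4_union_verts_def mem_Times_iff)
  next
    fix p assume p: "p \<in> C4_union_verts k"
    then have "p \<in> C4_union_verts (Suc k)" "fst p < k" by (auto simp: C4_union_verts_def)
    then show "p \<in> f ` W" using h[of p] by (intro image_eqI[of _ _ "h p"]) (auto simp: W_def)
  qed
  moreover have "\<forall>x\<in>W. \<forall>z\<in>W. E x z \<longleftrightarrow> C4_union_edge k (f x) (f z)"
    using f(2) by (auto simp: W_def C4_union_edge_def C4_union_verts_def mem_Times_iff less_SucI)
  ultimately have "graph_iso W E (C4_union_verts k) (C4_union_edge k)"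
    unfolding graph_iso_def by (intro exI[of _ f]) simp
  then have CW: "C4_union W" by (rule Suc.IH)
  have no: "\<not> E x u" if "x \<in> {c 0, c 1, c 2, c 3}" "u \<in> W" for x u
  proof -
    have "fst (f x) = k" "x \<in> U" "u \<in> U" "fst (f u) < k" using that c by (auto simp: W_def)
    then show ?thesis using f(2) by (auto simp: C4_union_edge_def)
  qed
  have disj: "{c 0, c 1, c 2, c 3} \<inter> W = {}" using c by (auto simp: W_def)
  have ne: "c 0 \<noteq> c 2" "c 1 \<noteq> c 3"
    using c(2)[of 0] c(2)[of 1] c(2)[of 2] c(2)[of 3] by auto
  have E: "E (c 0) (c 1)" "E (c 1) (c 2)" "E (c 2) (c 3)" "E (c 3) (c 0)"
    by (rule edge; simp)+
  have "C4_union (W \<union> {c 0, c 1, c 2, c 3})"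
    by (rule C4_union.add[OF CW disj E ne]) (use no in blast)
  then show ?case using U by simp
qed

end

section \<open>From \<open>rho\<close> back to the number of maximal dissociation sets\<close>

theorem theorem1p2:
  fixes V :: "'a set" and E :: "'a \<Rightarrow> 'a \<Rightarrow> bool" and n :: nat
  assumes "simple_graph V E" and "triangle_free V E" and "n = card V"
  shows "real (phi V E) \<le> 6 powr (real n / 4)
    \<and> (real (phi V E) = 6 powr (real n / 4) \<longleftrightarrow>
         (n mod 4 = 0 \<and> graph_iso V E (C4_union_verts (n div 4)) (C4_union_edge (n div 4))))"
proof -
  note graph = assms(1)[unfolded simple_graph_def]
  have fin: "finite V" by (rule conjunct1[OF graph])
  have edge: "x \<in> V" "z \<in> V" "E z x" if "E x z" for x z
    using graph that by (elim conjE; iprover)+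
  have "triangle_free_relation E"
  proof (rule triangle_free_relation.intro)
    show "E v u" if "E u v" for u v by (rule edge(3)[OF that])
    show "\<not> E v v" for v using graph by (elim conjE) (rule spec)
    show "\<not> E u w" if uv: "E u v" and vw: "E v w" for u v w
    proof
      assume "E u w"
      then have "\<exists>x\<in>V. \<exists>z\<in>V. \<exists>t\<in>V. E x z \<and> E z t \<and> E x t"
        using uv vw edge(1)[OF uv] edge(1)[OF vw] edge(2)[OF vw]
        by (intro bexI[of _ u] bexI[of _ v] bexI[of _ w] conjI)
      then show False using assms(2) unfolding triangle_free_def by (rule notE[rotated])
    qed
  qed
  then interpret triangle_free_relation E .
  let ?x = "6 powr (real n / 4)"
  \<comment> \<open>Since \<open>beta ^ n\<close> is the inverse of \<open>6 powr (n / 4)\<close>,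
    the bound and its equality case become \<open>rho V\<close> at most 1 and
    \<open>rho V = 1\<close>.\<close>
  have "beta ^ n = beta powr real n" using beta_pos by (simp add: powr_realpow)
  also have "\<dots> = 6 powr (- (real n / 4))" unfolding beta_def powr_powr by simp
  also have "\<dots> = inverse ?x" by (rule powr_minus)
  finally have beta_n: "beta ^ card V = inverse ?x" unfolding assms(3) .
  have rho: "rho V = real (phi V E) / ?x"
    unfolding rho_def beta_n by (rule divide_inverse[symmetric])
  have pos: "0 < ?x" by simp
  have bound: "real (phi V E) \<le> ?x \<longleftrightarrow> rho V \<le> 1" and eq: "real (phi V E) = ?x \<longleftrightarrow> rho V = 1"
    unfolding rho using divide_le_eq_1_pos[OF pos] pos by auto
  have "C4_union V \<longleftrightarrow>
      n mod 4 = 0 \<and> graph_iso V E (C4_union_verts (n div 4)) (C4_union_edge (n div 4))"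
  proof
    assume "C4_union V"
    then obtain k where "card V = 4 * k" "graph_iso V E (C4_union_verts k) (C4_union_edge k)"
      using C4_union_imp_iso by blast
    then show "n mod 4 = 0 \<and> graph_iso V E (C4_union_verts (n div 4)) (C4_union_edge (n div 4))"
      by (simp add: assms(3))
  qed (use iso_imp_C4_union in blast)
  moreover have "rho V = 1 \<longleftrightarrow> C4_union V" using rho_bound[OF fin] rho_C4_union by blast
  ultimately show ?thesis unfolding bound eq using rho_bound[OF fin] by simp
qed

end
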